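(* Let $f:X\to Y$, $g:X\to X'$, $g':Y\to Y'$ and $f':X'\to Y'$ be maps, and let $x_0\in X$ be such that $g'f(x_0)=f'g(x_0)$. Let $H:X\times I\to Y'$ be a homotopy from $g'\circ f$ to $f'\circ g$ such that $H(x_0,t)=g'f(x_0)$ for all $t\in I$. Let $P$ be the standard homotopy pull-back of $g'$ and $f'$, and let $h:X\to P$ be the corresponding whisker map. Then there exist fibrations $\hat I_h\to \hat I_f\to \hat I_{f'}$ and $\hat I_h\to \hat I_g\to \hat I_{g'}$, where for each $k\in \{ f,g,f',g',h\}$, $\hat I_{k}$ is a space that has the same homotopy type as the homotopy fibre $I_{k}$ of the map $k$. Further, the homotopy fibres $I_{\mathcal{I}(g,g')}$, $I_{\mathcal{I}(f,f')}$ and $I_h$ have the same homotopy type.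
   Context: Base points are $x_0\in X$, $y_0=f(x_0)\in Y$, $x_0'=g(x_0)\in X'$, $y_0'=g'f(x_0)=f'g(x_0)\in Y'$. For $x\in X$ let $\varphi(x)\in (Y')^I$ be the path $\varphi(x)(t)=H(x,t)$. The standard homotopy pull-back is $P=\{(y,\gamma,x')\in Y\times(Y')^I\times X'\mid \gamma(0)=g'(y),\ \gamma(1)=f'(x')\}$ and the whisker map is $h(x)=(f(x),\varphi(x),g(x))$, with base point $h(x_0)$ of $P$. For a pointed map $u:(A,a_0)\to(B,b_0)$, the homotopy fibre is $I_u=\{(a,\gamma)\in A\times B^I\mid\gamma(0)=u(a),\ \gamma(1)=b_0\}$, with base point $(a_0,c_{b_0})$, where $c_{b_0}$ is the constant path. The map $\mathcal I(g,g'):I_f\to I_{f'}$ is given by $\mathcal I(g,g')(x,\gamma)=(g(x),\varphi(x)^{-1}\ast(g'\circ\gamma))$, where $\ast$ is concatenation of paths and $\varphi(x)^{-1}$ is the reversed path. Symmetrically (using the reversed homotopy), $\mathcal I(f,f'):I_g\to I_{g'}$ is given by $\mathcal I(f,f')(x,\gamma)=(f(x),\varphi(x)\ast(f'\circ\gamma))$. *)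

theory Defs
  imports "HOL-Analysis.Analysis"
begin

section \<open>Path spaces\<close>

abbreviation unit_interval :: "real topology" where
  "unit_interval \<equiv> top_of_set {0..1}"

text \<open>Paths are kept extensional on the unit interval, so that two paths are equal as functions on
  the reals exactly if they agree on the interval.\<close>

definition paths :: "'b topology \<Rightarrow> (real \<Rightarrow> 'b) set" where
  "paths B = {\<gamma> \<in> extensional {0..1}. pathin B \<gamma>}"

text \<open>The space of paths with the compact-open topology.\<close>

definition path_space :: "'b topology \<Rightarrow> (real \<Rightarrow> 'b) topology" where
  "path_space B = topology_generated_by
     {{\<gamma> \<in> paths B. \<gamma> ` K \<subseteq> U} | K U. compact K \<and> K \<subseteq> {0..1} \<and> openin B U}"

definition const_path :: "'b \<Rightarrow> real \<Rightarrow> 'b" where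
  "const_path b = (\<lambda>t\<in>{0..1}. b)"

definition path_rev :: "(real \<Rightarrow> 'b) \<Rightarrow> real \<Rightarrow> 'b" where
  "path_rev \<gamma> = (\<lambda>t\<in>{0..1}. \<gamma> (1 - t))"

definition path_concat :: "(real \<Rightarrow> 'b) \<Rightarrow> (real \<Rightarrow> 'b) \<Rightarrow> real \<Rightarrow> 'b" where
  "path_concat \<gamma> \<delta> = (\<lambda>t\<in>{0..1}. if t \<le> 1/2 then \<gamma> (2 * t) else \<delta> (2 * t - 1))"

definition homotopy_track :: "('a \<times> real \<Rightarrow> 'b) \<Rightarrow> 'a \<Rightarrow> real \<Rightarrow> 'b" where
  "homotopy_track H x = (\<lambda>t\<in>{0..1}. H (x, t))"


section \<open>Homotopy pull-backs and homotopy fibres\<close>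

definition homotopy_pullback ::
  "'y topology \<Rightarrow> 'u topology \<Rightarrow> 'z topology \<Rightarrow> ('y \<Rightarrow> 'z) \<Rightarrow> ('u \<Rightarrow> 'z)
    \<Rightarrow> ('y \<times> (real \<Rightarrow> 'z) \<times> 'u) topology" where
  "homotopy_pullback Y X' Y' g' f' =
     subtopology (prod_topology Y (prod_topology (path_space Y') X'))
       {(y, \<gamma>, x'). \<gamma> 0 = g' y \<and> \<gamma> 1 = f' x'}"

definition whisker_map ::
  "('x \<Rightarrow> 'y) \<Rightarrow> ('x \<Rightarrow> 'u) \<Rightarrow> ('x \<times> real \<Rightarrow> 'z) \<Rightarrow> 'x \<Rightarrow> 'y \<times> (real \<Rightarrow> 'z) \<times> 'u" where
  "whisker_map f g H x = (f x, homotopy_track H x, g x)"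

definition homotopy_fibre ::
  "'a topology \<Rightarrow> 'b topology \<Rightarrow> 'b \<Rightarrow> ('a \<Rightarrow> 'b) \<Rightarrow> ('a \<times> (real \<Rightarrow> 'b)) topology" where
  "homotopy_fibre A B b0 u =
     subtopology (prod_topology A (path_space B)) {(a, \<gamma>). \<gamma> 0 = u a \<and> \<gamma> 1 = b0}"

definition fibre_base :: "'a \<Rightarrow> 'b \<Rightarrow> 'a \<times> (real \<Rightarrow> 'b)" where
  "fibre_base a0 b0 = (a0, const_path b0)"

text \<open>For a homotopy \<open>H\<close> from \<open>g' \<circ> f\<close> to \<open>f' \<circ> g\<close>, the map \<open>I(g, g')\<close> is
  \<open>fibre_map (\<lambda>x. path_rev (homotopy_track H x)) g g'\<close> and \<open>I(f, f')\<close> is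
  \<open>fibre_map (homotopy_track H) f f'\<close>.\<close>

definition fibre_map ::
  "('a \<Rightarrow> real \<Rightarrow> 'd) \<Rightarrow> ('a \<Rightarrow> 'c) \<Rightarrow> ('b \<Rightarrow> 'd)
    \<Rightarrow> 'a \<times> (real \<Rightarrow> 'b) \<Rightarrow> 'c \<times> (real \<Rightarrow> 'd)" where
  "fibre_map \<psi> v w = (\<lambda>(x, \<gamma>). (v x, path_concat (\<psi> x) (w \<circ> \<gamma>)))"


section \<open>Fibrations\<close>

definition homotopy_lifting_property ::
  "'t topology \<Rightarrow> 'e topology \<Rightarrow> 'b topology \<Rightarrow> ('e \<Rightarrow> 'b) \<Rightarrow> bool" where
  "homotopy_lifting_property T E B p \<longleftrightarrow>
     (\<forall>k G. continuous_map T E k \<and> continuous_map (prod_topology T unit_interval) B G \<and>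
            (\<forall>s\<in>topspace T. G (s, 0) = p (k s)) \<longrightarrow>
        (\<exists>K. continuous_map (prod_topology T unit_interval) E K \<and>
             (\<forall>s\<in>topspace T. K (s, 0) = k s) \<and>
             (\<forall>s\<in>topspace T. \<forall>t\<in>{0..1}. p (K (s, t)) = G (s, t))))"

text \<open>A Hurewicz fibration has the homotopy lifting property for all spaces. A definition cannot
  quantify over all types of points of the test space, so the test spaces here are all topologies on
  one type, chosen to be large enough to contain the mapping path space of \<open>p\<close>.
  The theorem \<open>hurewicz_fibration_lifting\<close> below shows that this already gives
  the property for test spaces over an arbitrary type.\<close>

definition hurewicz_fibration :: "'e topology \<Rightarrow> 'b topology \<Rightarrow> ('e \<Rightarrow> 'b) \<Rightarrow> bool" where
  "hurewicz_fibration E B p \<longleftrightarrow> continuous_map E B p \<and>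
     (\<forall>T :: ('e \<times> (real \<Rightarrow> 'b)) topology. homotopy_lifting_property T E B p)"

text \<open>\<open>F \<rightarrow> E \<rightarrow> B\<close> with maps \<open>i\<close> and \<open>p\<close>: a fibration \<open>p\<close> of based spaces, together
  with a homeomorphism \<open>i\<close> from \<open>F\<close> onto the fibre of \<open>p\<close> over the base point.\<close>

definition fibration_sequence ::
  "'f topology \<Rightarrow> 'f \<Rightarrow> 'e topology \<Rightarrow> 'e \<Rightarrow> 'b topology \<Rightarrow> 'b \<Rightarrow> ('f \<Rightarrow> 'e) \<Rightarrow> ('e \<Rightarrow> 'b) \<Rightarrow> bool" where
  "fibration_sequence F f0 E e0 B b0 i p \<longleftrightarrow>
     f0 \<in> topspace F \<and> e0 \<in> topspace E \<and> b0 \<in> topspace B \<and> i f0 = e0 \<and> p e0 = b0 \<and>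
     hurewicz_fibration E B p \<and>
     homeomorphic_map F (subtopology E {e. p e = b0}) i"

text \<open>Same (free) homotopy type, through a homotopy equivalence that respects the base points;
  the homotopies need not be based.\<close>

definition based_homotopy_equivalent ::
  "'a topology \<Rightarrow> 'a \<Rightarrow> 'b topology \<Rightarrow> 'b \<Rightarrow> bool" where
  "based_homotopy_equivalent A a0 B b0 \<longleftrightarrow>
     (\<exists>u v. continuous_map A B u \<and> continuous_map B A v \<and> u a0 = b0 \<and>
            homotopic_with (\<lambda>_. True) A A (v \<circ> u) id \<and>
            homotopic_with (\<lambda>_. True) B B (u \<circ> v) id)"

lemma based_homotopy_equivalent_imp:
  "based_homotopy_equivalent A a0 B b0 \<Longrightarrow> A homotopy_equivalent_space B"
  unfolding based_homotopy_equivalent_def homotopy_equivalent_space_def by blast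


section \<open>The exponential law for the interval and the lifting theorem\<close>

lemma topspace_path_space [simp]: "topspace (path_space B) = paths B"
proof -
  have "paths B \<in> {{\<gamma> \<in> paths B. \<gamma> ` K \<subseteq> U} | K U. compact K \<and> K \<subseteq> {0..1} \<and> openin B U}"
    by (rule CollectI, rule exI[of _ "{}"], rule exI[of _ "{}"]) auto
  then show ?thesis
    unfolding path_space_def topology_generated_by_topspace by blast
qed

lemma openin_path_space_subbasis:
  assumes "compact K" "K \<subseteq> {0..1}" "openin B U"
  shows "openin (path_space B) {\<gamma> \<in> paths B. \<gamma> ` K \<subseteq> U}"
  unfolding path_space_def by (rule topology_generated_by_Basis) (use assms in blast)

lemma continuous_map_curry_path:
  assumes G: "continuous_map (prod_topology T unit_interval) B G"
  shows "continuous_map T (path_space B) (homotopy_track G)"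
  unfolding path_space_def
proof (rule continuous_on_generated_topo)
  have inp: "homotopy_track G s \<in> paths B" if s: "s \<in> topspace T" for s
  proof -
    have "continuous_map unit_interval (prod_topology T unit_interval) (\<lambda>t. (s, t))"
      using s by (simp add: continuous_map_pairwise o_def)
    then have "continuous_map unit_interval B (\<lambda>t. G (s, t))"
      using continuous_map_compose[OF _ G] by (fastforce simp: o_def)
    then have "pathin B (homotopy_track G s)"
      unfolding pathin_def by (rule continuous_map_eq) (simp add: homotopy_track_def)
    then show ?thesis
      by (simp add: paths_def homotopy_track_def)
  qed
  show "homotopy_track G ` topspace T
      \<subseteq> \<Union> {{\<gamma> \<in> paths B. \<gamma> ` K \<subseteq> U} |K U. compact K \<and> K \<subseteq> {0..1} \<and> openin B U}"
    using inp topspace_path_space[of B] unfolding path_space_def topology_generated_by_topspace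
    by blast
  fix W assume "W \<in> {{\<gamma> \<in> paths B. \<gamma> ` K \<subseteq> U} |K U. compact K \<and> K \<subseteq> {0..1} \<and> openin B U}"
  then obtain K U where W: "W = {\<gamma> \<in> paths B. \<gamma> ` K \<subseteq> U}"
    and K: "compact K" "K \<subseteq> {0..1}" and U: "openin B U" by blast
  let ?O = "{z \<in> topspace (prod_topology T unit_interval). G z \<in> U}"
  have O: "openin (prod_topology T unit_interval) ?O"
    using G U by (rule openin_continuous_map_preimage)
  have KI: "compactin unit_interval K"
    using K by (simp add: compactin_subtopology)
  show "openin T (homotopy_track G -` W \<inter> topspace T)"
    unfolding openin_subopen[of T "homotopy_track G -` W \<inter> topspace T"]
  proof (intro ballI)
    fix s assume s: "s \<in> homotopy_track G -` W \<inter> topspace T"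
    have "{s} \<times> K \<subseteq> ?O"
      using s K by (auto simp: W homotopy_track_def subset_iff image_subset_iff)
    then obtain V1 V2 where V: "openin T V1" "openin unit_interval V2" "{s} \<subseteq> V1" "K \<subseteq> V2"
        "V1 \<times> V2 \<subseteq> ?O"
      using Wallace_theorem_prod_topology[of T "{s}" unit_interval K ?O] KI O s by auto
    have "V1 \<subseteq> homotopy_track G -` W \<inter> topspace T"
    proof
      fix r assume r: "r \<in> V1"
      then have rT: "r \<in> topspace T" using openin_subset[OF V(1)] by blast
      have "G (r, t) \<in> U" if "t \<in> K" for t
        using V(4,5) r that by blast
      then have "homotopy_track G r ` K \<subseteq> U"
        using K by (auto simp: homotopy_track_def subset_iff)
      then show "r \<in> homotopy_track G -` W \<inter> topspace T"
        using inp[OF rT] rT by (simp add: W)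
    qed
    then show "\<exists>V. openin T V \<and> s \<in> V \<and> V \<subseteq> homotopy_track G -` W \<inter> topspace T"
      using V by blast
  qed
qed

lemma continuous_map_path_eval:
  "continuous_map (prod_topology (path_space B) unit_interval) B (\<lambda>(\<gamma>, t). \<gamma> t)"
  unfolding continuous_map_def
proof (intro conjI allI impI)
  show "(\<lambda>(\<gamma>, t). \<gamma> t) \<in> topspace (prod_topology (path_space B) unit_interval) \<rightarrow> topspace B"
    by (auto simp: paths_def pathin_def continuous_map_def)
  fix U assume U: "openin B U"
  let ?S = "{z \<in> topspace (prod_topology (path_space B) unit_interval). (case z of (\<gamma>, t) \<Rightarrow> \<gamma> t) \<in> U}"
  show "openin (prod_topology (path_space B) unit_interval) ?S"
    unfolding openin_subopen[of _ ?S]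
  proof (intro ballI)
    fix z assume z: "z \<in> ?S"
    obtain \<gamma> t where zt: "z = (\<gamma>, t)" by (cases z)
    have g: "\<gamma> \<in> paths B" and t: "t \<in> {0..1}" and gU: "\<gamma> t \<in> U"
      using z by (auto simp: zt)
    have "openin unit_interval {s \<in> topspace unit_interval. \<gamma> s \<in> U}"
      using g U by (intro openin_continuous_map_preimage) (auto simp: paths_def pathin_def)
    then have "openin (top_of_set {0..1}) {s \<in> {0..1}. \<gamma> s \<in> U}" by simp
    then obtain e where e: "e > 0" "ball t e \<inter> {0..1} \<subseteq> {s \<in> {0..1}. \<gamma> s \<in> U}"
      using t gU unfolding openin_contains_ball by blast
    let ?K = "cball t (e/2) \<inter> {0..1::real}"
    let ?V = "ball t (e/2) \<inter> {0..1::real}"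
    have "?K \<subseteq> ball t e \<inter> {0..1}" using e(1) by (auto simp: dist_real_def)
    then have KU: "\<gamma> ` ?K \<subseteq> U" using e(2) by blast
    have o1: "openin (path_space B) {\<delta> \<in> paths B. \<delta> ` ?K \<subseteq> U}"
      by (rule openin_path_space_subbasis) (auto simp: U intro: compact_Int)
    have o2: "openin unit_interval ?V"
      by (metis Int_commute open_ball openin_open_Int)
    have "openin (prod_topology (path_space B) unit_interval) ({\<delta> \<in> paths B. \<delta> ` ?K \<subseteq> U} \<times> ?V)"
      using o1 o2 by (simp add: openin_prod_Times_iff)
    moreover have "z \<in> {\<delta> \<in> paths B. \<delta> ` ?K \<subseteq> U} \<times> ?V"
      using KU g t e(1) by (simp add: zt)
    moreover have "{\<delta> \<in> paths B. \<delta> ` ?K \<subseteq> U} \<times> ?V \<subseteq> ?S"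
      by (auto simp: image_subset_iff)
    ultimately show "\<exists>T. openin (prod_topology (path_space B) unit_interval) T \<and> z \<in> T \<and> T \<subseteq> ?S"
      by blast
  qed
qed

theorem hurewicz_fibration_lifting:
  fixes T :: "'t topology"
  assumes p: "hurewicz_fibration E B p"
  shows "homotopy_lifting_property T E B p"
  unfolding homotopy_lifting_property_def
proof (intro allI impI, elim conjE)
  fix k G
  assume k: "continuous_map T E k" and G: "continuous_map (prod_topology T unit_interval) B G"
    and G0: "\<forall>s\<in>topspace T. G (s, 0) = p (k s)"
  define N where "N = subtopology (prod_topology E (path_space B)) {(e, \<omega>). \<omega> 0 = p e}"
  have ev: "continuous_map (prod_topology N unit_interval) B (\<lambda>(z, t). snd z t)"
  proof -
    have "continuous_map N (path_space B) snd"
      unfolding N_def by (intro continuous_map_from_subtopology continuous_map_snd)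
    then have "continuous_map (prod_topology N unit_interval) (path_space B) (snd \<circ> fst)"
      using continuous_map_compose continuous_map_fst by blast
    then have "continuous_map (prod_topology N unit_interval) (prod_topology (path_space B) unit_interval)
        (\<lambda>z. (snd (fst z), snd z))"
      by (simp add: continuous_map_pairwise o_def continuous_map_snd)
    from continuous_map_compose[OF this continuous_map_path_eval] show ?thesis
      by (simp add: o_def case_prod_unfold)
  qed
  have "continuous_map N E fst"
    unfolding N_def by (intro continuous_map_from_subtopology continuous_map_fst)
  moreover have "\<forall>z\<in>topspace N. (\<lambda>(z, t). snd z t) (z, 0) = p (fst z)"
    by (auto simp: N_def)
  moreover have "homotopy_lifting_property N E B p"
    using p by (simp add: hurewicz_fibration_def)
  ultimately obtain L where L: "continuous_map (prod_topology N unit_interval) E L"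
    and L0: "\<forall>z\<in>topspace N. L (z, 0) = fst z"
    and L1: "\<forall>z\<in>topspace N. \<forall>t\<in>{0..1}. p (L (z, t)) = (\<lambda>(z, t). snd z t) (z, t)"
    using ev unfolding homotopy_lifting_property_def by blast
  define j where "j = (\<lambda>s. (k s, homotopy_track G s))"
  have "continuous_map T (prod_topology E (path_space B)) j"
    using k continuous_map_curry_path[OF G] by (simp add: continuous_map_pairwise o_def j_def)
  then have j: "continuous_map T N j"
    unfolding N_def continuous_map_in_subtopology
    using G0 by (auto simp: j_def homotopy_track_def)
  then have jN: "j s \<in> topspace N" if "s \<in> topspace T" for s
    using that by (auto simp: continuous_map_def)
  define K where "K = (\<lambda>(s, t). L (j s, t))"
  have "continuous_map (prod_topology T unit_interval) (prod_topology N unit_interval)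
      (\<lambda>z. (j (fst z), snd z))"
    using continuous_map_compose[OF continuous_map_fst j, of unit_interval]
    by (simp add: continuous_map_pairwise o_def continuous_map_snd)
  from continuous_map_compose[OF this L]
  have "continuous_map (prod_topology T unit_interval) E K"
    by (simp add: o_def case_prod_unfold K_def)
  moreover have "\<forall>s\<in>topspace T. K (s, 0) = k s"
    using L0 jN by (auto simp: K_def j_def)
  moreover have "\<forall>s\<in>topspace T. \<forall>t\<in>{0..1}. p (K (s, t)) = G (s, t)"
    using L1 jN by (auto simp: K_def j_def homotopy_track_def)
  ultimately show "\<exists>K. continuous_map (prod_topology T unit_interval) E K \<and>
      (\<forall>s\<in>topspace T. K (s, 0) = k s) \<and> (\<forall>s\<in>topspace T. \<forall>t\<in>{0..1}. p (K (s, t)) = G (s, t))"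
    by blast
qed

end

theory Submission
  imports Defs
begin

text \<open>
Each homotopy fibre \<open>I\<^sub>u\<close> of a map \<open>u : A \<rightarrow> B\<close> is the honest fibre of a Hurewicz fibration, namely of
evaluation at the end point on the mapping path space of \<open>u\<close>, and the mapping path space is homotopy
equivalent to \<open>A\<close> (\<open>hurewicz_fibration_mapping_path_space\<close>,
\<open>fibre_mapping_path_space\<close>, \<open>mapping_path_space_equivalent\<close>).
Applied to \<open>u = I(g, g') : I\<^sub>f \<rightarrow> I\<^sub>f\<^sub>'\<close>, this gives a fibration sequence
\<open>I\<^sub>u \<rightarrow> J\<^sub>f \<rightarrow> I\<^sub>f\<^sub>'\<close>, and likewise for \<open>I(f, f')\<close>. It remains to identify both fibres \<open>I\<^sub>u\<close> with one and
the same space, the homotopy fibre \<open>I\<^sub>h\<close> of the whisker map.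

A point of \<open>I\<^sub>h\<close> is a point \<open>x\<close> of \<open>X\<close>, a path \<open>\<beta>\<close> from \<open>f x\<close> to \<open>f x0\<close>, a path \<open>\<alpha>\<close> from \<open>g x\<close> to \<open>g x0\<close>,
and a square in \<open>Y'\<close> whose boundary consists of \<open>\<phi>(x)\<close>, \<open>g' \<circ> \<beta>\<close>, \<open>f' \<circ> \<alpha>\<close> and a constant edge. A point of
the homotopy fibre of \<open>I(g, g')\<close> consists of the same data, except that \<open>\<phi>(x)\<close> reversed and \<open>g' \<circ> \<beta>\<close>
together fill one edge of the square, and two edges are constant. The two boundary patterns agree
up to a piecewise linear reparametrisation of the boundary, which extends to a homeomorphism of the
square. Composition with it is therefore a homeomorphism between the two homotopy fibres
(\<open>homeomorphic_maps_square\<close>). The case of \<open>I(f, f')\<close> follows by reversing \<open>H\<close>: this exchanges the roles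
of \<open>f\<close> and \<open>g\<close>, and reversing paths in the homotopy pull-back identifies the two versions of \<open>I\<^sub>h\<close>
(\<open>homeomorphic_maps_pullback_flip\<close>).
\<close>

section \<open>Continuous families of paths\<close>

lemma continuous_map_comp:
  assumes "continuous_map R S a" "continuous_map S T b"
  shows "continuous_map R T (\<lambda>z. b (a z))"
  using continuous_map_compose[OF assms] by (simp add: o_def)

text \<open>Together with the next lemma this is the exponential law for the interval: continuity into a path
space is always obtained by currying a map with one more interval factor, and a path family is
always used by evaluating it at a continuously varying time.\<close>

lemma path_family_eval:
  assumes "continuous_map T (path_space B) \<gamma>" "continuous_map T unit_interval \<tau>"
  shows "continuous_map T B (\<lambda>z. \<gamma> z (\<tau> z))"
proof -
  have "continuous_map T (prod_topology (path_space B) unit_interval) (\<lambda>z. (\<gamma> z, \<tau> z))"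
    using assms by (simp add: continuous_map_pairwise o_def)
  from continuous_map_compose[OF this continuous_map_path_eval] show ?thesis
    by (simp add: o_def)
qed

lemma path_family_curry:
  assumes "continuous_map (prod_topology T unit_interval) B (\<lambda>p. G (fst p) (snd p))"
  shows "continuous_map T (path_space B) (\<lambda>z. \<lambda>t\<in>{0..1}. G z t)"
  using continuous_map_curry_path[OF assms] by (simp add: homotopy_track_def[abs_def])

lemma continuous_map_subst:
  assumes "continuous_map (prod_topology T S) B (\<lambda>p. G (fst p) (snd p))"
    "continuous_map R T a" "continuous_map R S b"
  shows "continuous_map R B (\<lambda>z. G (a z) (b z))"
proof -
  have "continuous_map R (prod_topology T S) (\<lambda>z. (a z, b z))"
    using assms by (simp add: continuous_map_pairwise o_def)
  from continuous_map_compose[OF this assms(1)] show ?thesis by (simp add: o_def)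
qed

lemma continuous_map_unit_interval_real:
  "continuous_map T unit_interval a \<Longrightarrow> continuous_map T euclideanreal a"
  by (simp add: continuous_map_in_subtopology)

text \<open>Concatenation in the form needed for variable reparametrisations: \<open>r\<close> is the time on the doubled
interval \<open>[0, 2]\<close>, and may itself depend on the parameter in any continuous way.\<close>

lemma continuous_map_glue:
  assumes \<Phi>: "continuous_map (prod_topology T unit_interval) B (\<lambda>p. \<Phi> (fst p) (snd p))"
    and \<Psi>: "continuous_map (prod_topology T unit_interval) B (\<lambda>p. \<Psi> (fst p) (snd p))"
    and r: "continuous_map T euclideanreal r" "\<And>z. z \<in> topspace T \<Longrightarrow> 0 \<le> r z \<and> r z \<le> 2"
    and eq: "\<And>z. z \<in> topspace T \<Longrightarrow> \<Phi> z 1 = \<Psi> z 0"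
  shows "continuous_map T B (\<lambda>z. if r z \<le> 1 then \<Phi> z (r z) else \<Psi> z (r z - 1))"
proof -
  have id: "continuous_map T T (\<lambda>z. z)" by simp
  \<comment> \<open>Clamping the parameter makes each half continuous on all of \<open>T\<close>.\<close>
  have "continuous_map T unit_interval (\<lambda>z. min 1 (r z))"
    "continuous_map T unit_interval (\<lambda>z. max 0 (r z - 1))"
    using r by (auto simp: continuous_map_in_subtopology intro!: continuous_intros)
  then have "continuous_map T B (\<lambda>z. \<Phi> z (min 1 (r z)))"
    "continuous_map T B (\<lambda>z. \<Psi> z (max 0 (r z - 1)))"
    using continuous_map_subst[OF \<Phi> id] continuous_map_subst[OF \<Psi> id] by blast+
  then have "continuous_map T B
      (\<lambda>z. if r z \<le> 1 then \<Phi> z (min 1 (r z)) else \<Psi> z (max 0 (r z - 1)))"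
    using r(1) eq by (intro continuous_map_cases_le)
      (auto intro: continuous_map_from_subtopology)
  then show ?thesis
    by (rule continuous_map_eq) (auto simp: min_def max_def)
qed

lemma path_family_concat:
  assumes \<gamma>: "continuous_map (prod_topology T unit_interval) B (\<lambda>p. \<gamma> (fst p) (snd p))"
    and \<delta>: "continuous_map (prod_topology T unit_interval) B (\<lambda>p. \<delta> (fst p) (snd p))"
    and eq: "\<And>z. z \<in> topspace T \<Longrightarrow> \<gamma> z 1 = \<delta> z 0"
  shows "continuous_map T (path_space B) (\<lambda>z. path_concat (\<gamma> z) (\<delta> z))"
proof -
  let ?TI = "prod_topology T unit_interval"
  have fst2: "continuous_map (prod_topology ?TI unit_interval) T (\<lambda>q. fst (fst q))"
    using continuous_map_compose[OF continuous_map_fst continuous_map_fst] by (simp add: o_def)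
  have r: "continuous_map ?TI euclideanreal (\<lambda>p. 2 * snd p)"
    by (intro continuous_intros continuous_map_unit_interval_real continuous_map_snd)
  have "continuous_map ?TI B
      (\<lambda>p. if 2 * snd p \<le> 1 then \<gamma> (fst p) (2 * snd p) else \<delta> (fst p) (2 * snd p - 1))"
    using r eq
    by (intro continuous_map_glue[of T for T, OF continuous_map_subst[OF \<gamma> fst2 continuous_map_snd]
        continuous_map_subst[OF \<delta> fst2 continuous_map_snd]]) auto
  then have "continuous_map ?TI B (\<lambda>p. if snd p \<le> 1/2 then \<gamma> (fst p) (2 * snd p)
      else \<delta> (fst p) (2 * snd p - 1))"
    by (rule continuous_map_eq) auto
  from path_family_curry[OF this] show ?thesis
    by (simp add: path_concat_def)
qed

lemma path_family_const:
  assumes "continuous_map T B a"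
  shows "continuous_map T (path_space B) (\<lambda>z. const_path (a z))"
  unfolding const_path_def
  using continuous_map_compose[OF continuous_map_fst assms]
  by (intro path_family_curry) (simp add: o_def)

lemma const_path_in_paths: "b \<in> topspace B \<Longrightarrow> const_path b \<in> paths B"
  by (simp add: paths_def const_path_def pathin_def continuous_map_eq[of _ _ "\<lambda>t. b"])


section \<open>Homotopy fibres and homotopy pull-backs\<close>

lemma continuous_map_into_homotopy_fibre:
  "continuous_map T (homotopy_fibre A B b u) w \<longleftrightarrow>
     continuous_map T A (\<lambda>z. fst (w z)) \<and> continuous_map T (path_space B) (\<lambda>z. snd (w z)) \<and>
     (\<forall>z\<in>topspace T. snd (w z) 0 = u (fst (w z)) \<and> snd (w z) 1 = b)"
  unfolding homotopy_fibre_def continuous_map_in_subtopology continuous_map_pairwise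
  by (auto simp: o_def case_prod_unfold)

lemma continuous_map_into_homotopy_pullback:
  "continuous_map T (homotopy_pullback Y X' Y' g' f') w \<longleftrightarrow>
     continuous_map T Y (\<lambda>z. fst (w z)) \<and>
     continuous_map T (path_space Y') (\<lambda>z. fst (snd (w z))) \<and>
     continuous_map T X' (\<lambda>z. snd (snd (w z))) \<and>
     (\<forall>z\<in>topspace T. fst (snd (w z)) 0 = g' (fst (w z)) \<and> fst (snd (w z)) 1 = f' (snd (snd (w z))))"
  unfolding homotopy_pullback_def continuous_map_in_subtopology continuous_map_pairwise
  by (auto simp: o_def case_prod_unfold)

lemma topspace_homotopy_fibre:
  "topspace (homotopy_fibre A B b u) =
     {(a, \<gamma>). a \<in> topspace A \<and> \<gamma> \<in> paths B \<and> \<gamma> 0 = u a \<and> \<gamma> 1 = b}"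
  by (auto simp: homotopy_fibre_def)

lemma topspace_homotopy_pullback:
  "topspace (homotopy_pullback Y X' Y' g' f') =
     {(y, \<gamma>, x'). y \<in> topspace Y \<and> \<gamma> \<in> paths Y' \<and> x' \<in> topspace X' \<and> \<gamma> 0 = g' y \<and> \<gamma> 1 = f' x'}"
  by (auto simp: homotopy_pullback_def)

lemma paths_in: "\<gamma> \<in> paths B \<Longrightarrow> t \<in> {0..1} \<Longrightarrow> \<gamma> t \<in> topspace B"
  by (auto simp: paths_def pathin_def continuous_map_def)

lemma paths_ext:
  assumes "\<gamma> \<in> paths B" "\<delta> \<in> extensional {0..1}" "\<And>t. t \<in> {0..1} \<Longrightarrow> \<delta> t = \<gamma> t"
  shows "\<delta> = \<gamma>"
  using assms by (intro extensionalityI[of _ "{0..1}"]) (auto simp: paths_def)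

lemma fibre_base_in_homotopy_fibre:
  assumes "a \<in> topspace A" "u a = b" "b \<in> topspace B"
  shows "fibre_base a b \<in> topspace (homotopy_fibre A B b u)"
  using assms const_path_in_paths[of b B]
  by (auto simp: topspace_homotopy_fibre fibre_base_def const_path_def)

section \<open>The mapping path space fibration\<close>

text \<open>The classical replacement of a map \<open>u : A \<rightarrow> B\<close> by a fibration: \<open>A\<close> is embedded by constant paths,
and evaluation of the path at its end point takes over the role of \<open>u\<close>.\<close>

definition mapping_path_space ::
  "'a topology \<Rightarrow> 'b topology \<Rightarrow> ('a \<Rightarrow> 'b) \<Rightarrow> ('a \<times> (real \<Rightarrow> 'b)) topology" where
  "mapping_path_space A B u =
     subtopology (prod_topology A (path_space B)) {(a, \<omega>). \<omega> 0 = u a}"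

lemma continuous_map_into_mapping_path_space:
  "continuous_map T (mapping_path_space A B u) w \<longleftrightarrow>
     continuous_map T A (\<lambda>z. fst (w z)) \<and> continuous_map T (path_space B) (\<lambda>z. snd (w z)) \<and>
     (\<forall>z\<in>topspace T. snd (w z) 0 = u (fst (w z)))"
  unfolding mapping_path_space_def continuous_map_in_subtopology continuous_map_pairwise
  by (auto simp: o_def case_prod_unfold)

lemma topspace_mapping_path_space:
  "topspace (mapping_path_space A B u) = {(a, \<omega>). a \<in> topspace A \<and> \<omega> \<in> paths B \<and> \<omega> 0 = u a}"
  by (auto simp: mapping_path_space_def)

text \<open>The homotopy fibre is thus an honest fibre, with equality of topologies and not only a
homeomorphism.\<close>

lemma fibre_mapping_path_space:
  "subtopology (mapping_path_space A B u) {e. snd e 1 = b} = homotopy_fibre A B b u"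
  unfolding mapping_path_space_def homotopy_fibre_def subtopology_subtopology
  by (rule arg_cong[of _ _ "subtopology _"]) auto

text \<open>A path \<open>\<omega>\<close> ending at \<open>G (s, 0)\<close> is lifted along \<open>G\<close> by lengthening it: at time \<open>t\<close> the lift runs
through \<open>\<omega>\<close> and then through \<open>G (s, -)\<close> on \<open>[0, t]\<close>, all at the constant speed \<open>1 + t\<close>. With this
parametrisation the lift at time \<open>0\<close> is exactly \<open>\<omega>\<close>, as the lifting property demands.\<close>

lemma hurewicz_fibration_mapping_path_space:
  "hurewicz_fibration (mapping_path_space A B u) B (\<lambda>e. snd e 1)"
  unfolding hurewicz_fibration_def
proof (intro conjI allI)
  let ?E = "mapping_path_space A B u"
  have idE: "continuous_map ?E ?E (\<lambda>e. e)" by simp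
  show "continuous_map ?E B (\<lambda>e. snd e 1)"
    by (rule path_family_eval) (use idE[unfolded continuous_map_into_mapping_path_space] in auto)
  fix T :: "(('a \<times> (real \<Rightarrow> 'b)) \<times> (real \<Rightarrow> 'b)) topology"
  show "homotopy_lifting_property T ?E B (\<lambda>e. snd e 1)"
    unfolding homotopy_lifting_property_def
  proof (intro allI impI, elim conjE)
    fix k G
    assume k: "continuous_map T ?E k" and G: "continuous_map (prod_topology T unit_interval) B G"
      and G0: "\<forall>s\<in>topspace T. G (s, 0) = snd (k s) 1"
    let ?TI = "prod_topology T unit_interval" and ?TII = "prod_topology (prod_topology T unit_interval) unit_interval"
    define K where "K = (\<lambda>p. (fst (k (fst p)),
      \<lambda>\<tau>\<in>{0..1}. if \<tau> * (1 + snd p) \<le> 1 then snd (k (fst p)) (\<tau> * (1 + snd p))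
                 else G (fst p, \<tau> * (1 + snd p) - 1)))"
    have kT: "continuous_map T A (\<lambda>s. fst (k s))" "continuous_map T (path_space B) (\<lambda>s. snd (k s))"
      "\<And>s. s \<in> topspace T \<Longrightarrow> snd (k s) 0 = u (fst (k s))"
      using k by (auto simp: continuous_map_into_mapping_path_space)
    have f1: "continuous_map (prod_topology ?TII unit_interval) T (\<lambda>q. fst (fst (fst q)))"
      by (rule continuous_map_comp[OF continuous_map_fst
          continuous_map_comp[OF continuous_map_fst continuous_map_fst]])
    have eqn: "continuous_map ?TII B (\<lambda>q. if snd q * (1 + snd (fst q)) \<le> 1
        then snd (k (fst (fst q))) (snd q * (1 + snd (fst q)))
        else G (fst (fst q), snd q * (1 + snd (fst q)) - 1))"
    proof (rule continuous_map_glue)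
      show "continuous_map (prod_topology ?TII unit_interval) B (\<lambda>p. snd (k (fst (fst (fst p)))) (snd p))"
        by (rule path_family_eval[OF continuous_map_comp[OF f1 kT(2)] continuous_map_snd])
      show "continuous_map (prod_topology ?TII unit_interval) B (\<lambda>p. G (fst (fst (fst p)), snd p))"
        by (rule continuous_map_subst[of T unit_interval B "\<lambda>s t. G (s, t)", OF _ f1 continuous_map_snd])
          (simp add: G)
      show "continuous_map ?TII euclideanreal (\<lambda>q. snd q * (1 + snd (fst q)))"
        by (intro continuous_map_real_mult continuous_map_add continuous_map_canonical_const
            continuous_map_unit_interval_real[OF continuous_map_snd]
            continuous_map_unit_interval_real[OF continuous_map_comp[OF continuous_map_fst continuous_map_snd]])
      show "0 \<le> snd q * (1 + snd (fst q)) \<and> snd q * (1 + snd (fst q)) \<le> 2" if "q \<in> topspace ?TII" for q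
      proof -
        have "0 \<le> snd q" "snd q \<le> 1" "0 \<le> snd (fst q)" "snd (fst q) \<le> 1"
          using that by auto
        then show ?thesis
          using mult_mono[of "snd q" 1 "1 + snd (fst q)" 2] by auto
      qed
      show "\<And>z. z \<in> topspace ?TII \<Longrightarrow> snd (k (fst (fst z))) 1 = G (fst (fst z), 0)"
        using G0 by auto
    qed
    have "continuous_map ?TI ?E K"
      unfolding continuous_map_into_mapping_path_space
      using kT(3) continuous_map_compose[OF continuous_map_fst kT(1), of unit_interval]
        path_family_curry[OF eqn]
      by (auto simp: K_def o_def)
    moreover have "K (s, 0) = k s" if s: "s \<in> topspace T" for s
    proof -
      have "k s \<in> topspace ?E" using k s by (auto simp: continuous_map_def)
      then have "snd (k s) \<in> paths B" by (auto simp: topspace_mapping_path_space)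
      then have "snd (K (s, 0)) = snd (k s)"
        by (rule paths_ext) (auto simp: K_def)
      then show ?thesis by (simp add: K_def prod_eq_iff)
    qed
    moreover have "snd (K (s, t)) 1 = G (s, t)" if "s \<in> topspace T" "t \<in> {0..1}" for s t
      using G0 that by (auto simp: K_def)
    ultimately show "\<exists>K. continuous_map ?TI ?E K \<and> (\<forall>s\<in>topspace T. K (s, 0) = k s) \<and>
        (\<forall>s\<in>topspace T. \<forall>t\<in>{0..1}. snd (K (s, t)) 1 = G (s, t))"
      by blast
  qed
qed

text \<open>The homotopy shrinks each path to its initial point.\<close>

lemma mapping_path_space_equivalent:
  assumes u: "continuous_map A B u"
  shows "based_homotopy_equivalent (mapping_path_space A B u) (a0, \<omega>0) A a0"
  unfolding based_homotopy_equivalent_def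
proof (intro exI conjI)
  let ?E = "mapping_path_space A B u"
  have idE: "continuous_map ?E ?E (\<lambda>e. e)" by simp
  have E: "continuous_map ?E A fst" "continuous_map ?E (path_space B) snd"
    using idE[unfolded continuous_map_into_mapping_path_space] by blast+
  show "continuous_map ?E A fst" by (rule E)
  show "continuous_map A ?E (\<lambda>a. (a, const_path (u a)))"
    using path_family_const[OF u] by (auto simp: continuous_map_into_mapping_path_space const_path_def)
  show "fst (a0, \<omega>0) = a0" by simp
  show "homotopic_with (\<lambda>_. True) A A (fst \<circ> (\<lambda>a. (a, const_path (u a)))) id"
    by (simp add: o_def id_def)
  let ?h = "\<lambda>p. (fst (snd p), \<lambda>\<tau>\<in>{0..1}. snd (snd p) (fst p * \<tau>))"
  show "homotopic_with (\<lambda>_. True) ?E ?E ((\<lambda>a. (a, const_path (u a))) \<circ> fst) id"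
  proof (subst homotopic_with, simp, intro exI[of _ ?h] conjI ballI)
    let ?IE = "prod_topology unit_interval ?E"
    have "continuous_map (prod_topology ?IE unit_interval) B (\<lambda>q. snd (snd (fst q)) (fst (fst q) * snd q))"
    proof (rule path_family_eval)
      show "continuous_map (prod_topology ?IE unit_interval) (path_space B) (\<lambda>q. snd (snd (fst q)))"
        by (rule continuous_map_comp[OF continuous_map_fst continuous_map_comp[OF continuous_map_snd E(2)]])
      have "continuous_map (prod_topology ?IE unit_interval) euclideanreal (\<lambda>q. fst (fst q) * snd q)"
        by (intro continuous_map_real_mult
            continuous_map_unit_interval_real[OF continuous_map_snd]
            continuous_map_unit_interval_real[OF continuous_map_comp[OF continuous_map_fst continuous_map_fst]])
      then show "continuous_map (prod_topology ?IE unit_interval) unit_interval (\<lambda>q. fst (fst q) * snd q)"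
        by (auto simp: continuous_map_in_subtopology mult_le_one)
    qed
    from path_family_curry[OF this]
    show "continuous_map ?IE ?E ?h"
      using continuous_map_compose[OF continuous_map_snd E(1), of unit_interval]
      by (auto simp: continuous_map_into_mapping_path_space o_def topspace_mapping_path_space)
    fix e assume e: "e \<in> topspace ?E"
    then show "?h (0, e) = ((\<lambda>a. (a, const_path (u a))) \<circ> fst) e"
      by (auto simp: topspace_mapping_path_space const_path_def)
    have "(\<lambda>\<tau>\<in>{0..1}. snd e (1 * \<tau>)) = snd e"
      using e by (intro paths_ext[of "snd e" B]) (auto simp: topspace_mapping_path_space)
    then show "?h (1, e) = id e" by (simp add: prod_eq_iff)
  qed simp
qed

lemma fibration_sequence_of_homeomorphic_fibre:
  assumes a0: "a0 \<in> topspace A" "u a0 = b0" "b0 \<in> topspace B"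
    and i: "homeomorphic_map F (homotopy_fibre A B b0 u) i"
    and f0: "f0 \<in> topspace F" "i f0 = fibre_base a0 b0"
  shows "fibration_sequence F f0 (mapping_path_space A B u) (fibre_base a0 b0) B b0 i (\<lambda>e. snd e 1)"
  unfolding fibration_sequence_def
  using a0 f0 i hurewicz_fibration_mapping_path_space[of A B u]
    const_path_in_paths[OF a0(3)]
  by (auto simp: fibre_mapping_path_space fibre_base_def topspace_mapping_path_space const_path_def)

section \<open>A piecewise linear homeomorphism of the square\<close>

text \<open>The homeomorphism \<open>(t, s) \<mapsto> (bend1 t s, bend2 t s)\<close> of the unit square, with inverse
\<open>(t, s) \<mapsto> (unbend1 t s, unbend2 t s)\<close>. Cut the source into three triangles by the segments from
\<open>(0, 1/2)\<close> to \<open>(1, 0)\<close> and \<open>(1, 1)\<close>, and the target by the segments from \<open>(0, 0)\<close> to \<open>(1, 1)\<close> and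
\<open>(1, 1/2)\<close>. The map is affine on each triangle and on the boundary it acts as follows:

  \<^item> the bottom edge goes to the top edge;
  \<^item> the lower half of the left edge goes to the left edge, with its direction reversed;
  \<^item> the upper half of the left edge goes to the bottom edge;
  \<^item> the top and right edges together go to the right edge.

So the left edge, carrying a concatenation of two paths, is bent around a corner. The formulas with
\<open>max\<close> and \<open>min\<close> are the piecewise affine functions on these triangulations; written like this,
their continuity needs no gluing.\<close>

definition bend1 :: "real \<Rightarrow> real \<Rightarrow> real" where
  "bend1 t s = max t (2 * s - 1)"

definition bend2 :: "real \<Rightarrow> real \<Rightarrow> real" where
  "bend2 t s = max (1 - 2 * s) (max ((3 * t - 2 * s + 1) / 4) (t / 2))"

definition unbend1 :: "real \<Rightarrow> real \<Rightarrow> real" where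
  "unbend1 t s = min t (2 * s)"

definition unbend2 :: "real \<Rightarrow> real \<Rightarrow> real" where
  "unbend2 t s = max ((1 - s) / 2) (min ((1 + t) / 2) ((3 * t - 4 * s + 1) / 2))"

lemmas square_defs = bend1_def bend2_def unbend1_def unbend2_def

lemma square_maps_in_interval:
  assumes "t \<in> {0..1}" "s \<in> {0..1}"
  shows "bend1 t s \<in> {0..1}" "bend2 t s \<in> {0..1}" "unbend1 t s \<in> {0..1}" "unbend2 t s \<in> {0..1}"
  using assms by (auto simp: square_defs le_max_iff_disj min_le_iff_disj)

text \<open>The affine formulas on the three triangles, from the bottom to the top of the source square.\<close>

lemma bend_triangles:
  assumes "t \<in> {0..1}" "s \<in> {0..1}"
  shows "2 * s \<le> 1 - t \<Longrightarrow> bend1 t s = t \<and> bend2 t s = 1 - 2 * s"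
    "1 - t \<le> 2 * s \<Longrightarrow> 2 * s \<le> 1 + t \<Longrightarrow> bend1 t s = t \<and> bend2 t s = (3 * t - 2 * s + 1) / 4"
    "1 + t \<le> 2 * s \<Longrightarrow> bend1 t s = 2 * s - 1 \<and> bend2 t s = t / 2"
  using assms by (simp_all add: bend1_def bend2_def max_absorb1 max_absorb2)

text \<open>The images of the three triangles, from the top to the bottom of the target square.\<close>

lemma unbend_triangles:
  assumes "t \<in> {0..1}" "s \<in> {0..1}"
  shows "t \<le> s \<Longrightarrow> unbend1 t s = t \<and> unbend2 t s = (1 - s) / 2"
    "s \<le> t \<Longrightarrow> t \<le> 2 * s \<Longrightarrow> unbend1 t s = t \<and> unbend2 t s = (3 * t - 4 * s + 1) / 2"
    "2 * s \<le> t \<Longrightarrow> unbend1 t s = 2 * s \<and> unbend2 t s = (1 + t) / 2"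
  using assms by (simp_all add: unbend1_def unbend2_def max_absorb1 max_absorb2 min_absorb1 min_absorb2)

lemma bend_unbend:
  assumes "t \<in> {0..1}" "s \<in> {0..1}"
  shows "bend1 (unbend1 t s) (unbend2 t s) = t" "bend2 (unbend1 t s) (unbend2 t s) = s"
proof -
  note U = unbend_triangles[OF assms]
  note F = bend_triangles[OF square_maps_in_interval(3,4)[OF assms]]
  consider "t \<le> s" | "s \<le> t" "t \<le> 2 * s" | "2 * s \<le> t" by linarith
  then have "bend1 (unbend1 t s) (unbend2 t s) = t \<and> bend2 (unbend1 t s) (unbend2 t s) = s"
  proof cases
    case 1
    then have e: "unbend1 t s = t" "unbend2 t s = (1 - s) / 2"
      using U(1) by auto
    have "2 * unbend2 t s \<le> 1 - unbend1 t s"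
      unfolding e using 1 by (auto simp: field_simps)
    from F(1)[OF this] show ?thesis
      unfolding e by (simp add: field_simps)
  next
    case 2
    then have e: "unbend1 t s = t" "unbend2 t s = (3 * t - 4 * s + 1) / 2"
      using U(2) by auto
    have "1 - unbend1 t s \<le> 2 * unbend2 t s" "2 * unbend2 t s \<le> 1 + unbend1 t s"
      unfolding e using 2 by (auto simp: field_simps)
    from F(2)[OF this] show ?thesis
      unfolding e by (simp add: field_simps)
  next
    case 3
    then have e: "unbend1 t s = 2 * s" "unbend2 t s = (1 + t) / 2"
      using U(3) by auto
    have "1 + unbend1 t s \<le> 2 * unbend2 t s"
      unfolding e using 3 by (auto simp: field_simps)
    from F(3)[OF this] show ?thesis
      unfolding e by (simp add: field_simps)
  qed
  then show "bend1 (unbend1 t s) (unbend2 t s) = t" "bend2 (unbend1 t s) (unbend2 t s) = s"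
    by auto
qed

lemma unbend_bend:
  assumes "t \<in> {0..1}" "s \<in> {0..1}"
  shows "unbend1 (bend1 t s) (bend2 t s) = t" "unbend2 (bend1 t s) (bend2 t s) = s"
proof -
  note F = bend_triangles[OF assms]
  note U = unbend_triangles[OF square_maps_in_interval(1,2)[OF assms]]
  consider "2 * s \<le> 1 - t" | "1 - t \<le> 2 * s" "2 * s \<le> 1 + t" | "1 + t \<le> 2 * s" by linarith
  then have "unbend1 (bend1 t s) (bend2 t s) = t \<and> unbend2 (bend1 t s) (bend2 t s) = s"
  proof cases
    case 1
    then have e: "bend1 t s = t" "bend2 t s = 1 - 2 * s"
      using F(1) by auto
    have "bend1 t s \<le> bend2 t s"
      unfolding e using 1 by (auto simp: field_simps)
    from U(1)[OF this] show ?thesis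
      unfolding e by (simp add: field_simps)
  next
    case 2
    then have e: "bend1 t s = t" "bend2 t s = (3 * t - 2 * s + 1) / 4"
      using F(2) by auto
    have "bend2 t s \<le> bend1 t s" "bend1 t s \<le> 2 * bend2 t s"
      unfolding e using 2 by (auto simp: field_simps)
    from U(2)[OF this] show ?thesis
      unfolding e by (simp add: field_simps)
  next
    case 3
    then have e: "bend1 t s = 2 * s - 1" "bend2 t s = t / 2"
      using F(3) by auto
    have "2 * bend2 t s \<le> bend1 t s"
      unfolding e using 3 by (auto simp: field_simps)
    from U(3)[OF this] show ?thesis
      unfolding e by (simp add: field_simps)
  qed
  then show "unbend1 (bend1 t s) (bend2 t s) = t" "unbend2 (bend1 t s) (bend2 t s) = s"
    by auto
qed

lemma continuous_map_unit_intervalI: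
  assumes "continuous_map T euclideanreal h" "\<And>z. z \<in> topspace T \<Longrightarrow> h z \<in> {0..1}"
  shows "continuous_map T unit_interval h"
  using assms unfolding continuous_map_in_subtopology by blast

lemma continuous_map_square_maps:
  assumes "continuous_map T unit_interval a" "continuous_map T unit_interval b"
  shows "continuous_map T unit_interval (\<lambda>z. bend1 (a z) (b z))"
    "continuous_map T unit_interval (\<lambda>z. bend2 (a z) (b z))"
    "continuous_map T unit_interval (\<lambda>z. unbend1 (a z) (b z))"
    "continuous_map T unit_interval (\<lambda>z. unbend2 (a z) (b z))"
proof -
  note ab = assms[THEN continuous_map_unit_interval_real]
  have I: "a z \<in> {0..1}" "b z \<in> {0..1}" if "z \<in> topspace T" for z
    using assms that unfolding continuous_map_in_subtopology by blast+
  note intros = continuous_map_real_max continuous_map_real_min continuous_map_add continuous_map_diff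
    continuous_map_real_mult continuous_map_canonical_const ab
  show "continuous_map T unit_interval (\<lambda>z. bend1 (a z) (b z))"
    by (rule continuous_map_unit_intervalI[OF _ square_maps_in_interval(1)[OF I]])
      (unfold bend1_def, intro intros)
  show "continuous_map T unit_interval (\<lambda>z. bend2 (a z) (b z))"
    by (rule continuous_map_unit_intervalI[OF _ square_maps_in_interval(2)[OF I]])
      (unfold bend2_def divide_inverse, intro intros)
  show "continuous_map T unit_interval (\<lambda>z. unbend1 (a z) (b z))"
    by (rule continuous_map_unit_intervalI[OF _ square_maps_in_interval(3)[OF I]])
      (unfold unbend1_def, intro intros)
  show "continuous_map T unit_interval (\<lambda>z. unbend2 (a z) (b z))"
    by (rule continuous_map_unit_intervalI[OF _ square_maps_in_interval(4)[OF I]])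
      (unfold unbend2_def divide_inverse, intro intros)
qed

section \<open>The homotopy fibre of the whisker map\<close>

text \<open>A path in the homotopy pull-back consists of paths \<open>\<beta>\<close> in \<open>Y\<close> and \<open>\<alpha>\<close> in \<open>X'\<close> together with a square
in \<open>Y'\<close> whose bottom edge is \<open>g' \<circ> \<beta>\<close> and whose top edge is \<open>f' \<circ> \<alpha>\<close>. In the homotopy fibre of \<open>I(g, g')\<close> the bottom
edge of the square is \<open>f' \<circ> \<alpha>\<close>, and the left edge has to be the reversed path \<open>\<phi>(x)\<close> followed by \<open>g' \<circ> \<beta>\<close>. Composing the
square with the homeomorphism above turns one kind of boundary into the other.\<close>

definition bend_square :: "'x \<times> (real \<Rightarrow> 'y \<times> (real \<Rightarrow> 'z) \<times> 'u)
    \<Rightarrow> ('x \<times> (real \<Rightarrow> 'y)) \<times> (real \<Rightarrow> 'u \<times> (real \<Rightarrow> 'z))" where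
  "bend_square w = ((fst w, \<lambda>t\<in>{0..1}. fst (snd w t)),
     \<lambda>t\<in>{0..1}. (snd (snd (snd w t)),
       \<lambda>s\<in>{0..1}. fst (snd (snd w (bend1 t s))) (bend2 t s)))"

definition unbend_square :: "('x \<times> (real \<Rightarrow> 'y)) \<times> (real \<Rightarrow> 'u \<times> (real \<Rightarrow> 'z))
    \<Rightarrow> 'x \<times> (real \<Rightarrow> 'y \<times> (real \<Rightarrow> 'z) \<times> 'u)" where
  "unbend_square w = (fst (fst w),
     \<lambda>t\<in>{0..1}. (snd (fst w) t,
       \<lambda>s\<in>{0..1}. snd (snd w (unbend1 t s)) (unbend2 t s), fst (snd w t)))"

lemma continuous_map_interval_reverse:
  assumes "continuous_map T unit_interval a"
  shows "continuous_map T unit_interval (\<lambda>z. 1 - a z)"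
proof (rule continuous_map_unit_intervalI)
  show "continuous_map T euclideanreal (\<lambda>z. 1 - a z)"
    by (intro continuous_map_diff continuous_map_canonical_const
        continuous_map_unit_interval_real assms)
  show "1 - a z \<in> {0..1}" if "z \<in> topspace T" for z
    using assms that unfolding continuous_map_in_subtopology by fastforce
qed

text \<open>The data of a homotopy commutative square with a base point. Reversing the homotopy and exchanging
the two sides of the square gives another instance, which is how the statements about \<open>f\<close> and \<open>f'\<close>
yield those about \<open>g\<close> and \<open>g'\<close>.\<close>

locale homotopy_square =
  fixes X :: "'x topology" and Y :: "'y topology" and X' :: "'u topology" and Y' :: "'z topology"
    and f :: "'x \<Rightarrow> 'y" and g :: "'x \<Rightarrow> 'u" and g' :: "'y \<Rightarrow> 'z" and f' :: "'u \<Rightarrow> 'z"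
    and H :: "'x \<times> real \<Rightarrow> 'z" and x0 :: 'x
  assumes f: "continuous_map X Y f" and g: "continuous_map X X' g"
    and g': "continuous_map Y Y' g'" and f': "continuous_map X' Y' f'"
    and x0: "x0 \<in> topspace X" and comm: "g' (f x0) = f' (g x0)"
    and H: "continuous_map (prod_topology X unit_interval) Y' H"
    and H0: "\<And>x. x \<in> topspace X \<Longrightarrow> H (x, 0) = g' (f x)"
    and H1: "\<And>x. x \<in> topspace X \<Longrightarrow> H (x, 1) = f' (g x)"
    and Hx0: "\<And>t. t \<in> {0..1} \<Longrightarrow> H (x0, t) = f' (g x0)"
begin

abbreviation "pullback \<equiv> homotopy_pullback Y X' Y' g' f'"
abbreviation "whisker \<equiv> whisker_map f g H"
abbreviation "fibre_h \<equiv> homotopy_fibre X pullback (whisker x0) whisker"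
abbreviation "fibre_f \<equiv> homotopy_fibre X Y (f x0) f"
abbreviation "fibre_f' \<equiv> homotopy_fibre X' Y' (f' (g x0)) f'"
abbreviation "base_f' \<equiv> fibre_base (g x0) (f' (g x0))"
abbreviation "comparison \<equiv> fibre_map (\<lambda>x. path_rev (homotopy_track H x)) g g'"
abbreviation "fibre_comparison \<equiv> homotopy_fibre fibre_f fibre_f' base_f' comparison"

lemma whisker_in: "x \<in> topspace X \<Longrightarrow> whisker x \<in> topspace pullback"
  using f g continuous_map_curry_path[OF H] H0[of x] H1[of x]
  by (auto simp: topspace_homotopy_pullback whisker_map_def continuous_map_def homotopy_track_def Pi_iff)

lemma comparison_continuous: "continuous_map fibre_f fibre_f' comparison"
proof -
  have idf: "continuous_map fibre_f fibre_f (\<lambda>w. w)" by simp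
  have F: "continuous_map fibre_f X fst" "continuous_map fibre_f (path_space Y) snd"
    using idf[unfolded continuous_map_into_homotopy_fibre] by blast+
  let ?FI = "prod_topology fibre_f unit_interval"
  have "continuous_map fibre_f (path_space Y')
      (\<lambda>w. path_concat (path_rev (homotopy_track H (fst w))) (g' \<circ> snd w))"
  proof (rule path_family_concat)
    have rev: "continuous_map ?FI unit_interval (\<lambda>p. 1 - snd p)"
      by (rule continuous_map_interval_reverse[OF continuous_map_snd])
    have "continuous_map ?FI Y' (\<lambda>p. H (fst (fst p), 1 - snd p))"
      by (rule continuous_map_subst[of X unit_interval Y' "\<lambda>x t. H (x, t)",
            OF _ continuous_map_comp[OF continuous_map_fst F(1)] rev]) (simp add: H)
    then show "continuous_map ?FI Y' (\<lambda>p. path_rev (homotopy_track H (fst (fst p))) (snd p))"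
      by (rule continuous_map_eq) (auto simp: path_rev_def homotopy_track_def)
    show "continuous_map ?FI Y' (\<lambda>p. (g' \<circ> snd (fst p)) (snd p))"
      unfolding o_def
      by (rule continuous_map_comp[OF path_family_eval[OF
              continuous_map_comp[OF continuous_map_fst F(2)] continuous_map_snd] g'])
    show "path_rev (homotopy_track H (fst w)) 1 = (g' \<circ> snd w) 0" if "w \<in> topspace fibre_f" for w
      using that H0[of "fst w"] by (auto simp: topspace_homotopy_fibre path_rev_def homotopy_track_def)
  qed
  moreover have "continuous_map fibre_f X' (\<lambda>w. g (fst w))"
    by (rule continuous_map_comp[OF F(1) g])
  ultimately show ?thesis
    unfolding continuous_map_into_homotopy_fibre
    using H1 comm
    by (auto simp: fibre_map_def case_prod_unfold topspace_homotopy_fibre path_concat_def path_rev_def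
        homotopy_track_def)
qed

lemma base_f'_in: "base_f' \<in> topspace fibre_f'"
  using g f' x0 by (intro fibre_base_in_homotopy_fibre) (auto simp: continuous_map_def)

lemma base_f_in: "fibre_base x0 (f x0) \<in> topspace fibre_f"
  using f x0 by (intro fibre_base_in_homotopy_fibre) (auto simp: continuous_map_def)

lemma base_h_in: "fibre_base x0 (whisker x0) \<in> topspace fibre_h"
  using whisker_in x0 by (intro fibre_base_in_homotopy_fibre) auto

lemma track_x0: "homotopy_track H x0 = const_path (f' (g x0))"
  by (rule ext) (simp add: homotopy_track_def const_path_def restrict_def Hx0)

lemma comparison_base: "comparison (fibre_base x0 (f x0)) = base_f'"
  by (rule prod_eqI) (auto simp: fibre_map_def fibre_base_def track_x0 path_concat_def path_rev_def
      const_path_def restrict_def comm)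

lemma bend_square_base:
  "bend_square (fibre_base x0 (whisker x0)) = fibre_base (fibre_base x0 (f x0)) base_f'"
  using square_maps_in_interval
  by (intro prod_eqI ext) (auto simp: bend_square_def fibre_base_def whisker_map_def track_x0
      const_path_def restrict_def)

lemma fibre_hD:
  assumes "w \<in> topspace fibre_h"
  shows "fst w \<in> topspace X" "snd w \<in> paths pullback" "snd w 0 = whisker (fst w)"
    "snd w 1 = whisker x0"
    "t \<in> {0..1} \<Longrightarrow> snd w t \<in> topspace pullback"
    "t \<in> {0..1} \<Longrightarrow> fst (snd (snd w t)) \<in> paths Y'"
    "t \<in> {0..1} \<Longrightarrow> fst (snd (snd w t)) 0 = g' (fst (snd w t))"
    "t \<in> {0..1} \<Longrightarrow> fst (snd (snd w t)) 1 = f' (snd (snd (snd w t)))"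
proof -
  show 1: "fst w \<in> topspace X" "snd w \<in> paths pullback" "snd w 0 = whisker (fst w)"
    "snd w 1 = whisker x0"
    using assms by (auto simp: topspace_homotopy_fibre)
  show 2: "snd w t \<in> topspace pullback" if "t \<in> {0..1}"
    using paths_in[OF 1(2) that] .
  show "t \<in> {0..1} \<Longrightarrow> fst (snd (snd w t)) \<in> paths Y'"
    "t \<in> {0..1} \<Longrightarrow> fst (snd (snd w t)) 0 = g' (fst (snd w t))"
    "t \<in> {0..1} \<Longrightarrow> fst (snd (snd w t)) 1 = f' (snd (snd (snd w t)))"
    using 2 by (auto simp: topspace_homotopy_pullback)
qed

lemma fibre_comparisonD:
  assumes "w \<in> topspace fibre_comparison"
  shows "fst (fst w) \<in> topspace X" "snd (fst w) \<in> paths Y" "snd (fst w) 0 = f (fst (fst w))"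
    "snd (fst w) 1 = f x0" "snd w \<in> paths fibre_f'"
    "fst (snd w 0) = g (fst (fst w))"
    "snd (snd w 0) = path_concat (path_rev (homotopy_track H (fst (fst w)))) (g' \<circ> snd (fst w))"
    "snd w 1 = base_f'"
    "t \<in> {0..1} \<Longrightarrow> snd (snd w t) \<in> paths Y'"
    "t \<in> {0..1} \<Longrightarrow> snd (snd w t) 0 = f' (fst (snd w t))"
    "t \<in> {0..1} \<Longrightarrow> snd (snd w t) 1 = f' (g x0)"
proof -
  show "fst (fst w) \<in> topspace X" "snd (fst w) \<in> paths Y" "snd (fst w) 0 = f (fst (fst w))"
    "snd (fst w) 1 = f x0" and 1: "snd w \<in> paths fibre_f'"
    and "fst (snd w 0) = g (fst (fst w))"
    "snd (snd w 0) = path_concat (path_rev (homotopy_track H (fst (fst w)))) (g' \<circ> snd (fst w))"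
    "snd w 1 = base_f'"
    using assms by (auto simp: topspace_homotopy_fibre fibre_map_def)
  show "t \<in> {0..1} \<Longrightarrow> snd (snd w t) \<in> paths Y'"
    "t \<in> {0..1} \<Longrightarrow> snd (snd w t) 0 = f' (fst (snd w t))"
    "t \<in> {0..1} \<Longrightarrow> snd (snd w t) 1 = f' (g x0)"
    using paths_in[OF 1, of t] by (auto simp: topspace_homotopy_fibre)
qed

lemma continuous_map_bend_square: "continuous_map fibre_h fibre_comparison bend_square"
proof -
  have idh: "continuous_map fibre_h fibre_h (\<lambda>w. w)" by simp
  have W: "continuous_map fibre_h X fst" "continuous_map fibre_h (path_space pullback) snd"
    using idh[unfolded continuous_map_into_homotopy_fibre] by blast+
  have ev: "continuous_map R Y (\<lambda>z. fst (snd (w z) (\<tau> z)))"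
      "continuous_map R (path_space Y') (\<lambda>z. fst (snd (snd (w z) (\<tau> z))))"
      "continuous_map R X' (\<lambda>z. snd (snd (snd (w z) (\<tau> z))))"
    if "continuous_map R fibre_h w" "continuous_map R unit_interval \<tau>"
    for R :: "'r topology" and w \<tau>
    using path_family_eval[OF continuous_map_comp[OF that(1) W(2)] that(2)]
    by (auto simp: continuous_map_into_homotopy_pullback)
  let ?WI = "prod_topology fibre_h unit_interval"
  let ?WII = "prod_topology ?WI unit_interval"
  have ff: "continuous_map ?WII fibre_h (\<lambda>q. fst (fst q))"
    and sf: "continuous_map ?WII unit_interval (\<lambda>q. snd (fst q))"
    by (rule continuous_map_comp[OF continuous_map_fst continuous_map_fst]
        continuous_map_comp[OF continuous_map_fst continuous_map_snd])+
  have "continuous_map fibre_h (path_space Y) (\<lambda>w. \<lambda>t\<in>{0..1}. fst (snd w t))"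
    by (rule path_family_curry, rule ev(1)[OF continuous_map_fst continuous_map_snd])
  moreover have "continuous_map ?WII Y'
      (\<lambda>q. fst (snd (snd (fst (fst q)) (bend1 (snd (fst q)) (snd q)))) (bend2 (snd (fst q)) (snd q)))"
    by (rule path_family_eval[OF ev(2)[OF ff]])
      (intro continuous_map_square_maps sf continuous_map_snd)+
  then have "continuous_map ?WI (path_space Y')
      (\<lambda>p. \<lambda>s\<in>{0..1}. fst (snd (snd (fst p) (bend1 (snd p) s))) (bend2 (snd p) s))"
    by (rule path_family_curry)
  moreover have "fst (snd (snd w (bend1 t 0))) (bend2 t 0) = f' (snd (snd (snd w t)))"
    "fst (snd (snd w (bend1 t 1))) (bend2 t 1) = f' (g x0)"
    if "w \<in> topspace fibre_h" "t \<in> {0..1}" for w t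
  proof -
    have "bend1 t 0 = t" "bend2 t 0 = 1" "bend1 t 1 = 1"
      using that(2) by (auto simp: square_defs max_def)
    moreover have "bend2 t 1 \<in> {0..1}" using that(2) square_maps_in_interval by auto
    ultimately show "fst (snd (snd w (bend1 t 0))) (bend2 t 0) = f' (snd (snd (snd w t)))"
      "fst (snd (snd w (bend1 t 1))) (bend2 t 1) = f' (g x0)"
      using that fibre_hD(8)[OF that] fibre_hD(4)[OF that(1)]
      by (simp_all add: whisker_map_def track_x0 const_path_def)
  qed
  ultimately have "continuous_map ?WI fibre_f' (\<lambda>p. (snd (snd (snd (fst p) (snd p))),
       \<lambda>s\<in>{0..1}. fst (snd (snd (fst p) (bend1 (snd p) s))) (bend2 (snd p) s)))"
    unfolding continuous_map_into_homotopy_fibre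
    using ev(3)[OF continuous_map_fst continuous_map_snd] by auto
  then have "continuous_map fibre_h (path_space fibre_f')
     (\<lambda>w. \<lambda>t\<in>{0..1}. (snd (snd (snd w t)),
       \<lambda>s\<in>{0..1}. fst (snd (snd w (bend1 t s))) (bend2 t s)))"
    by (rule path_family_curry)
  moreover have "continuous_map fibre_h (path_space Y) (\<lambda>w. \<lambda>t\<in>{0..1}. fst (snd w t))" by fact
  moreover have "snd (bend_square w) 0 = comparison (fst (bend_square w))"
    if w: "w \<in> topspace fibre_h" for w
  proof (rule prod_eqI)
    have w0: "snd w 0 = (f (fst w), homotopy_track H (fst w), g (fst w))"
      using fibre_hD(3)[OF w] by (simp add: whisker_map_def)
    show "fst (snd (bend_square w) 0) = fst (comparison (fst (bend_square w)))"
      by (simp add: bend_square_def fibre_map_def w0)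
    show "snd (snd (bend_square w) 0) = snd (comparison (fst (bend_square w)))"
    proof
      fix s :: real
      \<comment> \<open>The lower half of the left edge carries the reversed track of \<open>H\<close>, the upper half \<open>g' \<circ> \<beta>\<close>.\<close>
      consider "s \<notin> {0..1}" | "0 \<le> s" "s \<le> 1/2" | "1/2 < s" "s \<le> 1" by fastforce
      then show "snd (snd (bend_square w) 0) s = snd (comparison (fst (bend_square w))) s"
      proof cases
        case 1
        then show ?thesis by (auto simp: bend_square_def fibre_map_def path_concat_def)
      next
        case 2
        then have "bend1 0 s = 0" "bend2 0 s = 1 - 2 * s" by (auto simp: square_defs max_def)
        with 2 show ?thesis
          by (simp add: bend_square_def fibre_map_def path_concat_def path_rev_def homotopy_track_def w0)
      next
        case 3
        then have "bend1 0 s = 2 * s - 1" "bend2 0 s = 0" by (auto simp: square_defs max_def)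
        with 3 fibre_hD(7)[OF w, of "2 * s - 1"] show ?thesis
          by (simp add: bend_square_def fibre_map_def path_concat_def)
      qed
    qed
  qed
  moreover have "snd (bend_square w) 1 = base_f'" if w: "w \<in> topspace fibre_h" for w
  proof -
    have w1: "snd w 1 = (f x0, const_path (f' (g x0)), g x0)"
      using fibre_hD(4)[OF w] by (simp add: whisker_map_def track_x0)
    have "bend1 1 s = 1 \<and> bend2 1 s \<in> {0..1}" if "s \<in> {0..1}" for s
      using that square_maps_in_interval[of 1 s] by (auto simp: bend1_def)
    then show ?thesis
      by (intro prod_eqI ext) (auto simp: bend_square_def fibre_base_def w1 const_path_def restrict_def)
  qed
  moreover have "snd (fst (bend_square w)) 0 = f (fst (fst (bend_square w)))"
    "snd (fst (bend_square w)) 1 = f x0" if w: "w \<in> topspace fibre_h" for w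
    using fibre_hD(3,4)[OF w] by (simp_all add: bend_square_def whisker_map_def)
  ultimately show ?thesis
    unfolding continuous_map_into_homotopy_fibre
    using W(1) by (auto simp: bend_square_def)
qed

lemma continuous_map_unbend_square: "continuous_map fibre_comparison fibre_h unbend_square"
proof -
  have idc: "continuous_map fibre_comparison fibre_comparison (\<lambda>w. w)" by simp
  have W: "continuous_map fibre_comparison X (\<lambda>w. fst (fst w))"
    "continuous_map fibre_comparison (path_space Y) (\<lambda>w. snd (fst w))"
    "continuous_map fibre_comparison (path_space fibre_f') snd"
    using idc[unfolded continuous_map_into_homotopy_fibre] by blast+
  have ev: "continuous_map R X' (\<lambda>z. fst (snd (w z) (\<tau> z)))"
      "continuous_map R (path_space Y') (\<lambda>z. snd (snd (w z) (\<tau> z)))"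
    if "continuous_map R fibre_comparison w" "continuous_map R unit_interval \<tau>"
    for R :: "'r topology" and w \<tau>
    using path_family_eval[OF continuous_map_comp[OF that(1) W(3)] that(2)]
    by (auto simp: continuous_map_into_homotopy_fibre)
  let ?WI = "prod_topology fibre_comparison unit_interval"
  let ?WII = "prod_topology ?WI unit_interval"
  have ff: "continuous_map ?WII fibre_comparison (\<lambda>q. fst (fst q))"
    and sf: "continuous_map ?WII unit_interval (\<lambda>q. snd (fst q))"
    by (rule continuous_map_comp[OF continuous_map_fst continuous_map_fst]
        continuous_map_comp[OF continuous_map_fst continuous_map_snd])+
  have "continuous_map ?WII Y'
      (\<lambda>q. snd (snd (fst (fst q)) (unbend1 (snd (fst q)) (snd q))) (unbend2 (snd (fst q)) (snd q)))"
    by (rule path_family_eval[OF ev(2)[OF ff]])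
      (intro continuous_map_square_maps sf continuous_map_snd)+
  then have "continuous_map ?WI (path_space Y')
      (\<lambda>p. \<lambda>s\<in>{0..1}. snd (snd (fst p) (unbend1 (snd p) s)) (unbend2 (snd p) s))"
    by (rule path_family_curry)
  moreover have "snd (snd w (unbend1 t 0)) (unbend2 t 0) = g' (snd (fst w) t)"
    "snd (snd w (unbend1 t 1)) (unbend2 t 1) = f' (fst (snd w t))"
    if w: "w \<in> topspace fibre_comparison" and t: "t \<in> {0..1}" for w t
  proof -
    have e: "unbend1 t 0 = 0" "unbend2 t 0 = (1 + t) / 2" "unbend1 t 1 = t" "unbend2 t 1 = 0"
      using t unbend_triangles[of t 0] unbend_triangles[of t 1] by auto
    \<comment> \<open>At \<open>t = 0\<close> the time \<open>1/2\<close> still belongs to the first path of the concatenation.\<close>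
    have "path_concat (path_rev (homotopy_track H (fst (fst w)))) (g' \<circ> snd (fst w)) ((1 + t) / 2)
        = g' (snd (fst w) t)"
    proof (cases "t = 0")
      case True
      then show ?thesis
        using H0[OF fibre_comparisonD(1)[OF w]] fibre_comparisonD(3)[OF w]
        by (simp add: path_concat_def path_rev_def homotopy_track_def)
    next
      case False
      then show ?thesis
        using t by (simp add: path_concat_def add_divide_distrib)
    qed
    then show "snd (snd w (unbend1 t 0)) (unbend2 t 0) = g' (snd (fst w) t)"
      unfolding e fibre_comparisonD(7)[OF w] .
    show "snd (snd w (unbend1 t 1)) (unbend2 t 1) = f' (fst (snd w t))"
      unfolding e by (rule fibre_comparisonD(10)[OF w t])
  qed
  moreover have "continuous_map ?WI Y (\<lambda>p. snd (fst (fst p)) (snd p))"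
    by (rule path_family_eval[OF continuous_map_comp[OF continuous_map_fst W(2)] continuous_map_snd])
  ultimately have "continuous_map ?WI pullback (\<lambda>p. (snd (fst (fst p)) (snd p),
       \<lambda>s\<in>{0..1}. snd (snd (fst p) (unbend1 (snd p) s)) (unbend2 (snd p) s), fst (snd (fst p) (snd p))))"
    unfolding continuous_map_into_homotopy_pullback
    using ev(1)[OF continuous_map_fst continuous_map_snd] by auto
  then have "continuous_map fibre_comparison (path_space pullback)
     (\<lambda>w. \<lambda>t\<in>{0..1}. (snd (fst w) t,
       \<lambda>s\<in>{0..1}. snd (snd w (unbend1 t s)) (unbend2 t s), fst (snd w t)))"
    by (rule path_family_curry)
  moreover have "snd (unbend_square w) 0 = whisker (fst (unbend_square w))"
    if w: "w \<in> topspace fibre_comparison" for w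
  proof -
    have "snd (snd w (unbend1 0 s)) (unbend2 0 s) = H (fst (fst w), s)" if "s \<in> {0..1}" for s
    proof -
      have e: "unbend1 0 s = 0" "unbend2 0 s = (1 - s) / 2"
        using that by (auto simp: square_defs max_def min_def)
      show ?thesis
        unfolding e fibre_comparisonD(7)[OF w]
        using that by (simp add: path_concat_def path_rev_def homotopy_track_def diff_divide_distrib)
    qed
    then show ?thesis
      using fibre_comparisonD(3,6)[OF w]
      by (intro prod_eqI ext) (auto simp: unbend_square_def whisker_map_def homotopy_track_def restrict_def)
  qed
  moreover have "snd (unbend_square w) 1 = whisker x0"
    if w: "w \<in> topspace fibre_comparison" for w
  proof -
    have "snd (snd w (unbend1 1 s)) (unbend2 1 s) = f' (g x0)" if s: "s \<in> {0..1}" for s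
    \<comment> \<open>The right edge goes back to the top edge (lower half) and to the right edge (upper half).\<close>
    proof (cases "s \<le> 1/2")
      case True
      then have "unbend2 1 s = 1" "unbend1 1 s \<in> {0..1}"
        using s by (auto simp: square_defs max_def min_def)
      then show ?thesis using fibre_comparisonD(11)[OF w] by simp
    next
      case False
      then have "unbend1 1 s = 1" "unbend2 1 s \<in> {0..1}"
        using s by (auto simp: square_defs max_def min_def)
      then show ?thesis
        using fibre_comparisonD(8)[OF w] by (simp add: fibre_base_def const_path_def)
    qed
    then show ?thesis
      using fibre_comparisonD(4,8)[OF w]
      by (intro prod_eqI ext)
        (auto simp: unbend_square_def whisker_map_def track_x0 const_path_def fibre_base_def restrict_def)
  qed
  ultimately show ?thesis
    unfolding continuous_map_into_homotopy_fibre
    using W(1) by (auto simp: unbend_square_def)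
qed

text \<open>The two homotopy fibres are homeomorphic, not merely homotopy equivalent. This is what allows the
same space to serve as the fibre in both fibration sequences.\<close>

lemma homeomorphic_maps_square: "homeomorphic_maps fibre_h fibre_comparison bend_square unbend_square"
  unfolding homeomorphic_maps_def
proof (intro conjI ballI continuous_map_bend_square continuous_map_unbend_square)
  fix w assume w: "w \<in> topspace fibre_h"
  have "snd (unbend_square (bend_square w)) t = snd w t" if t: "t \<in> {0..1}" for t
  proof -
    have "fst (snd (snd (unbend_square (bend_square w)) t)) = fst (snd (snd w t))"
      using fibre_hD(6)[OF w t] t
      by (rule_tac paths_ext) (auto simp: unbend_square_def bend_square_def bend_unbend unbend_bend
          square_maps_in_interval[simplified])
    then show ?thesis
      using t by (simp add: prod_eq_iff unbend_square_def bend_square_def)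
  qed
  then have "snd (unbend_square (bend_square w)) = snd w"
    by (intro paths_ext[OF fibre_hD(2)[OF w]]) (auto simp: unbend_square_def)
  then show "unbend_square (bend_square w) = w"
    by (simp add: prod_eq_iff unbend_square_def bend_square_def)
next
  fix w assume w: "w \<in> topspace fibre_comparison"
  have "snd (bend_square (unbend_square w)) t = snd w t" if t: "t \<in> {0..1}" for t
  proof -
    have "snd (snd (bend_square (unbend_square w)) t) = snd (snd w t)"
      using fibre_comparisonD(9)[OF w t] t
      by (rule_tac paths_ext) (auto simp: unbend_square_def bend_square_def bend_unbend unbend_bend
          square_maps_in_interval[simplified])
    then show ?thesis
      using t by (simp add: prod_eq_iff unbend_square_def bend_square_def)
  qed
  then have "snd (bend_square (unbend_square w)) = snd w"
    by (intro paths_ext[OF fibre_comparisonD(5)[OF w]]) (auto simp: bend_square_def)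
  moreover have "snd (fst (bend_square (unbend_square w))) = snd (fst w)"
    by (intro paths_ext[OF fibre_comparisonD(2)[OF w]]) (auto simp: bend_square_def unbend_square_def)
  ultimately show "bend_square (unbend_square w) = w"
    by (simp add: prod_eq_iff unbend_square_def bend_square_def)
qed

text \<open>The parameter \<open>e\<close> is there because the fibre has to be the same space for the square and for its
mirror image, whose whisker maps have different, though homeomorphic, homotopy fibres.\<close>

lemma fibration_sequence_comparison:
  assumes e: "homeomorphic_map F fibre_h e" "k0 \<in> topspace F" "e k0 = fibre_base x0 (whisker x0)"
  shows "fibration_sequence F k0 (mapping_path_space fibre_f fibre_f' comparison)
     (fibre_base (fibre_base x0 (f x0)) base_f') fibre_f' base_f' (bend_square \<circ> e) (\<lambda>e. snd e 1)"
proof (rule fibration_sequence_of_homeomorphic_fibre)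
  show "homeomorphic_map F fibre_comparison (bend_square \<circ> e)"
    using e(1) homeomorphic_maps_square
    by (intro homeomorphic_map_compose) (auto simp: homeomorphic_map_maps)
qed (use e in \<open>auto simp: base_f_in base_f'_in comparison_base bend_square_base\<close>)

end

section \<open>Mirror images of squares\<close>

lemma continuous_map_homotopy_fibre_target:
  assumes r: "continuous_map B C r"
    and k: "\<And>a. a \<in> topspace A \<Longrightarrow> r (k a) = k' a" and b: "r b = b'"
  shows "continuous_map (homotopy_fibre A B b k) (homotopy_fibre A C b' k')
    (\<lambda>w. (fst w, \<lambda>t\<in>{0..1}. r (snd w t)))"
proof -
  let ?F = "homotopy_fibre A B b k"
  have idF: "continuous_map ?F ?F (\<lambda>w. w)" by simp
  have F: "continuous_map ?F A fst" "continuous_map ?F (path_space B) snd"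
    using idF[unfolded continuous_map_into_homotopy_fibre] by blast+
  have "continuous_map ?F (path_space C) (\<lambda>w. \<lambda>t\<in>{0..1}. r (snd w t))"
    by (rule path_family_curry, rule continuous_map_comp[OF path_family_eval[OF
            continuous_map_comp[OF continuous_map_fst F(2)] continuous_map_snd] r])
  then show ?thesis
    using F(1) k b by (auto simp: continuous_map_into_homotopy_fibre topspace_homotopy_fibre)
qed

lemma homotopy_fibre_target_homeomorphic:
  assumes r: "homeomorphic_maps B C r r'"
    and k: "\<And>a. a \<in> topspace A \<Longrightarrow> k a \<in> topspace B \<and> r (k a) = k' a"
    and b: "b \<in> topspace B" "r b = b'"
  shows "homeomorphic_maps (homotopy_fibre A B b k) (homotopy_fibre A C b' k')
    (\<lambda>w. (fst w, \<lambda>t\<in>{0..1}. r (snd w t))) (\<lambda>w. (fst w, \<lambda>t\<in>{0..1}. r' (snd w t)))"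
    (is "homeomorphic_maps ?F ?G ?u ?v")
proof -
  have inv: "\<And>y. y \<in> topspace B \<Longrightarrow> r' (r y) = y" "\<And>y. y \<in> topspace C \<Longrightarrow> r (r' y) = y"
    and rc: "continuous_map B C r" "continuous_map C B r'"
    using r by (auto simp: homeomorphic_maps_def)
  have k': "r' (k' a) = k a" if "a \<in> topspace A" for a
    using k[OF that] inv(1)[of "k a"] by simp
  have b': "r' b' = b"
    using b inv(1) by auto
  have "?v (?u w) = w" if "w \<in> topspace ?F" for w
  proof -
    have "snd w \<in> paths B" using that by (auto simp: topspace_homotopy_fibre)
    then have "snd (?v (?u w)) = snd w"
      by (rule paths_ext) (use paths_in[OF \<open>snd w \<in> paths B\<close>] inv(1) in auto)
    then show ?thesis by (simp add: prod_eq_iff)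
  qed
  moreover have "?u (?v w) = w" if "w \<in> topspace ?G" for w
  proof -
    have "snd w \<in> paths C" using that by (auto simp: topspace_homotopy_fibre)
    then have "snd (?u (?v w)) = snd w"
      by (rule paths_ext) (use paths_in[OF \<open>snd w \<in> paths C\<close>] inv(2) in auto)
    then show ?thesis by (simp add: prod_eq_iff)
  qed
  moreover have "continuous_map ?F ?G ?u"
    using k b by (intro continuous_map_homotopy_fibre_target rc) auto
  moreover have "continuous_map ?G ?F ?v"
    using k' b' by (intro continuous_map_homotopy_fibre_target rc)
  ultimately show ?thesis
    unfolding homeomorphic_maps_def by blast
qed

lemma path_rev_family:
  assumes "continuous_map T (path_space B) \<gamma>"
  shows "continuous_map T (path_space B) (\<lambda>z. path_rev (\<gamma> z))"
  unfolding path_rev_def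
proof (rule path_family_curry, rule path_family_eval)
  show "continuous_map (prod_topology T unit_interval) (path_space B) (\<lambda>p. \<gamma> (fst p))"
    by (rule continuous_map_comp[OF continuous_map_fst assms])
  show "continuous_map (prod_topology T unit_interval) unit_interval (\<lambda>p. 1 - snd p)"
    by (rule continuous_map_interval_reverse[OF continuous_map_snd])
qed

lemma path_rev_rev: "\<gamma> \<in> paths B \<Longrightarrow> path_rev (path_rev \<gamma>) = \<gamma>"
  by (rule paths_ext) (auto simp: path_rev_def)

text \<open>The homotopy pull-back does not depend, up to homeomorphism, on the order of the two maps; only the
path between them has to be reversed.\<close>

definition pullback_flip :: "'y \<times> (real \<Rightarrow> 'z) \<times> 'u \<Rightarrow> 'u \<times> (real \<Rightarrow> 'z) \<times> 'y" where
  "pullback_flip p = (snd (snd p), path_rev (fst (snd p)), fst p)"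

lemma continuous_map_pullback_flip:
  "continuous_map (homotopy_pullback Y X' Y' g' f') (homotopy_pullback X' Y Y' f' g') pullback_flip"
proof -
  let ?P = "homotopy_pullback Y X' Y' g' f'"
  have idP: "continuous_map ?P ?P (\<lambda>w. w)" by simp
  have "continuous_map ?P Y fst" "continuous_map ?P (path_space Y') (\<lambda>p. fst (snd p))"
    "continuous_map ?P X' (\<lambda>p. snd (snd p))"
    using idP[unfolded continuous_map_into_homotopy_pullback] by blast+
  then show ?thesis
    using path_rev_family[of ?P Y' "\<lambda>p. fst (snd p)"]
    by (auto simp: continuous_map_into_homotopy_pullback topspace_homotopy_pullback
        pullback_flip_def path_rev_def)
qed

lemma homeomorphic_maps_pullback_flip:
  "homeomorphic_maps (homotopy_pullback Y X' Y' g' f') (homotopy_pullback X' Y Y' f' g')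
     pullback_flip pullback_flip"
  by (auto simp: homeomorphic_maps_def continuous_map_pullback_flip topspace_homotopy_pullback
      pullback_flip_def path_rev_rev)

lemma based_homotopy_equivalent_refl: "based_homotopy_equivalent A a A a"
  unfolding based_homotopy_equivalent_def
  by (intro exI[of _ id]) simp

theorem proposition1p5:
  fixes X :: "'x topology" and Y :: "'y topology" and X' :: "'u topology" and Y' :: "'z topology"
    and f :: "'x \<Rightarrow> 'y" and g :: "'x \<Rightarrow> 'u" and g' :: "'y \<Rightarrow> 'z" and f' :: "'u \<Rightarrow> 'z"
    and H :: "'x \<times> real \<Rightarrow> 'z" and x0 :: 'x
  assumes "continuous_map X Y f" and "continuous_map X X' g"
    and "continuous_map Y Y' g'" and "continuous_map X' Y' f'"
    and "x0 \<in> topspace X" and "g' (f x0) = f' (g x0)"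
    and "continuous_map (prod_topology X unit_interval) Y' H"
    and "\<forall>x\<in>topspace X. H (x, 0) = g' (f x)"
    and "\<forall>x\<in>topspace X. H (x, 1) = f' (g x)"
    and "\<forall>t\<in>{0..1}. H (x0, t) = g' (f x0)"
  shows
    "(\<exists>(Jh :: ('x \<times> (real \<Rightarrow> 'y \<times> (real \<Rightarrow> 'z) \<times> 'u)) topology) jh
      (Jf :: (('x \<times> (real \<Rightarrow> 'y)) \<times> (real \<Rightarrow> 'u \<times> (real \<Rightarrow> 'z))) topology) jf
      (Jg :: (('x \<times> (real \<Rightarrow> 'u)) \<times> (real \<Rightarrow> 'y \<times> (real \<Rightarrow> 'z))) topology) jg
      (Jf' :: ('u \<times> (real \<Rightarrow> 'z)) topology) jf'
      (Jg' :: ('y \<times> (real \<Rightarrow> 'z)) topology) jg'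
      i p i' p'.
        fibration_sequence Jh jh Jf jf Jf' jf' i p \<and>
        fibration_sequence Jh jh Jg jg Jg' jg' i' p' \<and>
        based_homotopy_equivalent Jf jf
          (homotopy_fibre X Y (f x0) f) (fibre_base x0 (f x0)) \<and>
        based_homotopy_equivalent Jg jg
          (homotopy_fibre X X' (g x0) g) (fibre_base x0 (g x0)) \<and>
        based_homotopy_equivalent Jf' jf'
          (homotopy_fibre X' Y' (f' (g x0)) f') (fibre_base (g x0) (f' (g x0))) \<and>
        based_homotopy_equivalent Jg' jg'
          (homotopy_fibre Y Y' (g' (f x0)) g') (fibre_base (f x0) (g' (f x0))) \<and>
        based_homotopy_equivalent Jh jh
          (homotopy_fibre X (homotopy_pullback Y X' Y' g' f') (whisker_map f g H x0) (whisker_map f g H))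
          (fibre_base x0 (whisker_map f g H x0))) \<and>
     homotopy_fibre (homotopy_fibre X Y (f x0) f) (homotopy_fibre X' Y' (f' (g x0)) f')
        (fibre_base (g x0) (f' (g x0))) (fibre_map (\<lambda>x. path_rev (homotopy_track H x)) g g')
      homotopy_equivalent_space
     homotopy_fibre X (homotopy_pullback Y X' Y' g' f') (whisker_map f g H x0) (whisker_map f g H) \<and>
     homotopy_fibre (homotopy_fibre X X' (g x0) g) (homotopy_fibre Y Y' (g' (f x0)) g')
        (fibre_base (f x0) (g' (f x0))) (fibre_map (homotopy_track H) f f')
      homotopy_equivalent_space
     homotopy_fibre X (homotopy_pullback Y X' Y' g' f') (whisker_map f g H x0) (whisker_map f g H)"
proof -
  interpret S: homotopy_square X Y X' Y' f g g' f' H x0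
    using assms by unfold_locales auto
  define K where "K = (\<lambda>p. H (fst p, 1 - snd p))"
  interpret R: homotopy_square X X' Y Y' g f f' g' K x0
  proof
    show "continuous_map (prod_topology X unit_interval) Y' K"
      unfolding K_def
      by (rule continuous_map_subst[of X unit_interval Y' "\<lambda>x t. H (x, t)", OF _ continuous_map_fst
            continuous_map_interval_reverse[OF continuous_map_snd]]) (simp add: assms(7))
  qed (use assms in \<open>auto simp: K_def\<close>)
  have track: "path_rev (homotopy_track K x) = homotopy_track H x"
    "path_rev (homotopy_track H x) = homotopy_track K x" for x
    by (rule ext; simp add: path_rev_def homotopy_track_def restrict_def K_def)+
  let ?e = "\<lambda>w. (fst w, \<lambda>t\<in>{0..1}. pullback_flip (snd w t))"
  have flip: "pullback_flip (S.whisker x) = R.whisker x" for x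
    by (simp add: pullback_flip_def whisker_map_def track)
  have e: "homeomorphic_maps S.fibre_h R.fibre_h ?e ?e"
    using S.whisker_in S.x0 flip
    by (intro homotopy_fibre_target_homeomorphic homeomorphic_maps_pullback_flip) auto
  have e0: "?e (fibre_base x0 (S.whisker x0)) = fibre_base x0 (R.whisker x0)"
    by (rule prod_eqI) (auto simp: fibre_base_def const_path_def flip restrict_def)
  have seqS: "fibration_sequence S.fibre_h (fibre_base x0 (S.whisker x0))
      (mapping_path_space S.fibre_f S.fibre_f' S.comparison)
      (fibre_base (fibre_base x0 (f x0)) S.base_f') S.fibre_f' S.base_f' (bend_square \<circ> id) (\<lambda>e. snd e 1)"
    by (rule S.fibration_sequence_comparison) (simp_all add: S.base_h_in)
  have seqR: "fibration_sequence S.fibre_h (fibre_base x0 (S.whisker x0))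
      (mapping_path_space R.fibre_f R.fibre_f' R.comparison)
      (fibre_base (fibre_base x0 (g x0)) R.base_f') R.fibre_f' R.base_f' (bend_square \<circ> ?e) (\<lambda>e. snd e 1)"
    using e e0 S.base_h_in by (intro R.fibration_sequence_comparison) (auto simp: homeomorphic_map_maps)
  have eqv: "based_homotopy_equivalent (mapping_path_space S.fibre_f S.fibre_f' S.comparison)
      (fibre_base (fibre_base x0 (f x0)) S.base_f') S.fibre_f (fibre_base x0 (f x0))"
    "based_homotopy_equivalent (mapping_path_space R.fibre_f R.fibre_f' R.comparison)
      (fibre_base (fibre_base x0 (g x0)) R.base_f') R.fibre_f (fibre_base x0 (g x0))"
    unfolding fibre_base_def[of "fibre_base _ _"]
    by (rule mapping_path_space_equivalent S.comparison_continuous R.comparison_continuous)+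
  have hs: "S.fibre_h homeomorphic_space S.fibre_comparison"
    and he: "S.fibre_h homeomorphic_space R.fibre_h"
    and hr: "R.fibre_h homeomorphic_space R.fibre_comparison"
    using S.homeomorphic_maps_square e R.homeomorphic_maps_square
    unfolding homeomorphic_space_def by blast+
  note hS = homeomorphic_imp_homotopy_equivalent_space[OF hs[THEN homeomorphic_space_sym[THEN iffD1]]]
  note hR = homeomorphic_imp_homotopy_equivalent_space[OF
      homeomorphic_space_trans[OF he hr, THEN homeomorphic_space_sym[THEN iffD1]]]
  note eqv_refl = based_homotopy_equivalent_refl
  have hR': "homotopy_fibre R.fibre_f R.fibre_f' R.base_f' (fibre_map (homotopy_track H) f f')
      homotopy_equivalent_space S.fibre_h"
    using hR by (simp only: track)
  show ?thesis
    by (rule conjI[OF _ conjI[OF hS hR']], intro exI, intro conjI)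
      (rule seqS, rule seqR, rule eqv, rule eqv, rule eqv_refl, rule eqv_refl, rule eqv_refl)
qed

end
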